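(* Let $\mathcal{M}^3=\mathbb{R}^3$ with standard coordinates $(x_1,x_2,x_3)$, equipped with the Riemannian metric $$g=dx_1\otimes dx_1+e^{2x_1}dx_2\otimes dx_2+e^{-2x_1}dx_3\otimes dx_3,$$ let $\gamma\in\mathbb{R}$ be arbitrary, let $$X=\gamma\left(-2\frac{\partial}{\partial x_1}-4x_3\frac{\partial}{\partial x_3}\right)+(1-\gamma)\left(2\frac{\partial}{\partial x_1}-4x_2\frac{\partial}{\partial x_2}\right),$$ and let $\alpha=4$ (the $\mathrm{sol}^3$ soliton $(\mathcal{M}^3,g,X,4)$). Let $$Lh=\Delta_\ell h-\mathcal{L}_X h-4h$$ be the linearization at $(\mathcal{M}^3,g,X,4)$ of the modified Ricci flow $\frac{\partial}{\partial\tau}g=-2\operatorname{Rc}(g)-\mathcal{L}_Xg-4g$. Then this linearization is strictly linearly stable, in the sense that for every smooth compactly supported real symmetric $(2,0)$-tensor field $h$ on $\mathcal{M}^3$, $$\int_{\mathcal{M}^3}\langle Lh,h\rangle\,d\mu\le-\|\delta h\|^2-\omega\|h\|^2\qquad\text{with }\omega=\frac{5-\sqrt{17}}{2}>0.$$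
   Context: A $(2,0)$-tensor field is a covariant 2-tensor field $h=h_{ij}$. A Ricci soliton structure $(\mathcal{M}^n,g,X,\alpha)$ satisfies $2\operatorname{Rc}(g)+\alpha g+\mathcal{L}_Xg=0$; it is called expanding if $\alpha>0$. $\nabla$ is the Levi-Civita connection of $g$, $d\mu$ its volume measure, $\langle\cdot,\cdot\rangle$ the pointwise inner product on tensors induced by $g$ (so $|h|^2=g^{ik}g^{jl}h_{ij}h_{kl}$), and $\|\cdot\|$ the $L^2$ norm with respect to $d\mu$. $\delta$ is the formal divergence $(\delta h)_j=-\nabla^ih_{ij}$. $\mathcal{L}_X$ is the Lie derivative. $\Delta_\ell$ is the Lichnerowicz Laplacian $$\Delta_\ell h_{ij}=\Delta h_{ij}+2R_{ipqj}h^{pq}-R_i^kh_{kj}-R_j^kh_{ik},$$ where $\Delta=g^{ij}\nabla_i\nabla_j$ is the rough Laplacian, $R_{ij}$ is the Ricci tensor, and the sign convention for $R_{ijkl}$ is that $R_{ijji}$ is the sectional curvature of the plane spanned by orthonormal vectors $e_i,e_j$. The linearization is taken after the DeTurck modification (the vector field is varied together with the metric so as to make the linearized operator elliptic), which gives exactly the operator $L$ displayed in the claim. *)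

theory Defs
  imports "HOL-Analysis.Analysis"
begin

text \<open>
  Riemannian geometry on \<open>\<real>\<^sup>n\<close> in one global chart. A vector field, a covector field, a
  covariant 2-tensor field and a covariant 3-tensor field are the functions sending a point to the
  array of components in the coordinate frame; in particular \<open>g x $ i $ j\<close> is the component
  \<open>g\<^sub>i\<^sub>j\<close> of a metric \<open>g\<close> at \<open>x\<close>.
\<close>

type_synonym 'n vector_field = "real ^ 'n \<Rightarrow> real ^ 'n"
type_synonym 'n tensor1 = "real ^ 'n \<Rightarrow> real ^ 'n"
type_synonym 'n tensor2 = "real ^ 'n \<Rightarrow> real ^ 'n ^ 'n"
type_synonym 'n tensor3 = "real ^ 'n \<Rightarrow> real ^ 'n ^ 'n ^ 'n"

definition pd :: "'n::finite \<Rightarrow> (real ^ 'n \<Rightarrow> real) \<Rightarrow> real ^ 'n \<Rightarrow> real" where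
  "pd i f x = frechet_derivative f (at x) (axis i 1)"

text \<open>
  A function is smooth iff all its iterated partial derivatives (the list gives the indices)
  are totally differentiable everywhere; differentiability of those of order \<open>k + 1\<close> makes them
  continuous, so this is membership in \<open>C\<^sup>k\<close> for all \<open>k\<close>.
\<close>

definition smooth :: "(real ^ 'n::finite \<Rightarrow> real) \<Rightarrow> bool" where
  "smooth f \<longleftrightarrow> (\<forall>is x. fold pd is f differentiable at x)"

definition smooth_tensor2 :: "'n::finite tensor2 \<Rightarrow> bool" where
  "smooth_tensor2 h \<longleftrightarrow> (\<forall>i j. smooth (\<lambda>x. h x $ i $ j))"

definition symmetric_tensor2 :: "'n::finite tensor2 \<Rightarrow> bool" where
  "symmetric_tensor2 h \<longleftrightarrow> (\<forall>x. transpose (h x) = h x)"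

definition compactly_supported :: "('a::topological_space \<Rightarrow> 'b::zero) \<Rightarrow> bool" where
  "compactly_supported h \<longleftrightarrow> compact (closure {x. h x \<noteq> 0})"

text \<open>\<open>ginv g x $ i $ j\<close> is \<open>g\<^sup>i\<^sup>j\<close>.\<close>

definition ginv :: "'n::finite tensor2 \<Rightarrow> 'n tensor2" where
  "ginv g x = matrix_inv (g x)"

text \<open>\<open>christoffel g k i j x\<close> is \<open>\<Gamma>\<^sup>k\<^sub>i\<^sub>j\<close> of the Levi-Civita connection.\<close>

definition christoffel :: "'n::finite tensor2 \<Rightarrow> 'n \<Rightarrow> 'n \<Rightarrow> 'n \<Rightarrow> real ^ 'n \<Rightarrow> real" where
  "christoffel g k i j x = (1/2) * (\<Sum>l\<in>UNIV. ginv g x $ k $ l *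
     (pd i (\<lambda>y. g y $ j $ l) x + pd j (\<lambda>y. g y $ i $ l) x - pd l (\<lambda>y. g y $ i $ j) x))"

text \<open>
  The index of differentiation comes first: \<open>cov_deriv2 g h x $ k $ i $ j\<close> is
  \<open>\<nabla>\<^sub>k h\<^sub>i\<^sub>j\<close>, and \<open>cov_deriv3 g T m k i j x\<close> is \<open>\<nabla>\<^sub>m T\<^sub>k\<^sub>i\<^sub>j\<close>.
\<close>

definition cov_deriv2 :: "'n::finite tensor2 \<Rightarrow> 'n tensor2 \<Rightarrow> 'n tensor3" where
  "cov_deriv2 g h x = (\<chi> k i j. pd k (\<lambda>y. h y $ i $ j) x
     - (\<Sum>l\<in>UNIV. christoffel g l k i x * h x $ l $ j)
     - (\<Sum>l\<in>UNIV. christoffel g l k j x * h x $ i $ l))"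

definition cov_deriv3 ::
    "'n::finite tensor2 \<Rightarrow> 'n tensor3 \<Rightarrow> 'n \<Rightarrow> 'n \<Rightarrow> 'n \<Rightarrow> 'n \<Rightarrow> real ^ 'n \<Rightarrow> real" where
  "cov_deriv3 g T m k i j x = pd m (\<lambda>y. T y $ k $ i $ j) x
     - (\<Sum>l\<in>UNIV. christoffel g l m k x * T x $ l $ i $ j)
     - (\<Sum>l\<in>UNIV. christoffel g l m i x * T x $ k $ l $ j)
     - (\<Sum>l\<in>UNIV. christoffel g l m j x * T x $ k $ i $ l)"

definition rough_laplacian :: "'n::finite tensor2 \<Rightarrow> 'n tensor2 \<Rightarrow> 'n tensor2" where
  "rough_laplacian g h x = (\<chi> i j. \<Sum>m\<in>UNIV. \<Sum>k\<in>UNIV.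
     ginv g x $ m $ k * cov_deriv3 g (cov_deriv2 g h) m k i j x)"

text \<open>
  \<open>riemann_up g i j k l x\<close> is the \<open>l\<close>-th component of
  \<open>R(\<partial>\<^sub>i, \<partial>\<^sub>j) \<partial>\<^sub>k = \<nabla>\<^sub>i \<nabla>\<^sub>j \<partial>\<^sub>k - \<nabla>\<^sub>j \<nabla>\<^sub>i \<partial>\<^sub>k\<close>, and
  \<open>riemann g i j k l x\<close> is \<open>R\<^sub>i\<^sub>j\<^sub>k\<^sub>l = g(R(\<partial>\<^sub>i, \<partial>\<^sub>j) \<partial>\<^sub>k, \<partial>\<^sub>l)\<close>.
  Hence in an orthonormal frame \<open>R\<^sub>i\<^sub>j\<^sub>j\<^sub>i\<close> is the sectional curvature.
\<close>

definition riemann_up ::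
    "'n::finite tensor2 \<Rightarrow> 'n \<Rightarrow> 'n \<Rightarrow> 'n \<Rightarrow> 'n \<Rightarrow> real ^ 'n \<Rightarrow> real" where
  "riemann_up g i j k l x = pd i (christoffel g l j k) x - pd j (christoffel g l i k) x
     + (\<Sum>m\<in>UNIV. christoffel g m j k x * christoffel g l i m x
                 - christoffel g m i k x * christoffel g l j m x)"

definition riemann ::
    "'n::finite tensor2 \<Rightarrow> 'n \<Rightarrow> 'n \<Rightarrow> 'n \<Rightarrow> 'n \<Rightarrow> real ^ 'n \<Rightarrow> real" where
  "riemann g i j k l x = (\<Sum>m\<in>UNIV. riemann_up g i j k m x * g x $ m $ l)"

definition ricci :: "'n::finite tensor2 \<Rightarrow> 'n tensor2" where
  "ricci g x = (\<chi> j k. \<Sum>i\<in>UNIV. \<Sum>l\<in>UNIV. ginv g x $ i $ l * riemann g i j k l x)"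

definition lichnerowicz :: "'n::finite tensor2 \<Rightarrow> 'n tensor2 \<Rightarrow> 'n tensor2" where
  "lichnerowicz g h x = (\<chi> i j. rough_laplacian g h x $ i $ j
     + 2 * (\<Sum>p\<in>UNIV. \<Sum>q\<in>UNIV. \<Sum>a\<in>UNIV. \<Sum>b\<in>UNIV.
         riemann g i p q j x * ginv g x $ p $ a * ginv g x $ q $ b * h x $ a $ b)
     - (\<Sum>k\<in>UNIV. \<Sum>l\<in>UNIV. ginv g x $ k $ l * ricci g x $ i $ l * h x $ k $ j)
     - (\<Sum>k\<in>UNIV. \<Sum>l\<in>UNIV. ginv g x $ k $ l * ricci g x $ j $ l * h x $ i $ k))"

definition lie_deriv :: "'n::finite vector_field \<Rightarrow> 'n tensor2 \<Rightarrow> 'n tensor2" where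
  "lie_deriv X h x = (\<chi> i j. \<Sum>k\<in>UNIV. X x $ k * pd k (\<lambda>y. h y $ i $ j) x
     + h x $ k $ j * pd i (\<lambda>y. X y $ k) x + h x $ i $ k * pd j (\<lambda>y. X y $ k) x)"

text \<open>
  The linearization of \<open>g \<mapsto> - 2 Rc(g) - \<L>\<^sub>X g - \<alpha> g\<close> at \<open>(g, X, \<alpha>)\<close>,
  after the DeTurck modification.
\<close>

definition linearization ::
    "'n::finite tensor2 \<Rightarrow> 'n vector_field \<Rightarrow> real \<Rightarrow> 'n tensor2 \<Rightarrow> 'n tensor2" where
  "linearization g X \<alpha> h x = lichnerowicz g h x - lie_deriv X h x - \<alpha> *\<^sub>R h x"

text \<open>\<open>(\<delta> h)\<^sub>j = - \<nabla>\<^sup>i h\<^sub>i\<^sub>j\<close>\<close>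

definition divergence :: "'n::finite tensor2 \<Rightarrow> 'n tensor2 \<Rightarrow> 'n tensor1" where
  "divergence g h x =
     (\<chi> j. - (\<Sum>i\<in>UNIV. \<Sum>k\<in>UNIV. ginv g x $ i $ k * cov_deriv2 g h x $ k $ i $ j))"

definition inner1 ::
    "'n::finite tensor2 \<Rightarrow> 'n tensor1 \<Rightarrow> 'n tensor1 \<Rightarrow> real ^ 'n \<Rightarrow> real" where
  "inner1 g v w x = (\<Sum>i\<in>UNIV. \<Sum>j\<in>UNIV. ginv g x $ i $ j * v x $ i * w x $ j)"

definition inner2 ::
    "'n::finite tensor2 \<Rightarrow> 'n tensor2 \<Rightarrow> 'n tensor2 \<Rightarrow> real ^ 'n \<Rightarrow> real" where
  "inner2 g h u x = (\<Sum>i\<in>UNIV. \<Sum>j\<in>UNIV. \<Sum>k\<in>UNIV. \<Sum>l\<in>UNIV.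
     ginv g x $ i $ k * ginv g x $ j $ l * h x $ i $ j * u x $ k $ l)"

definition volume_measure :: "'n::finite tensor2 \<Rightarrow> (real ^ 'n) measure" where
  "volume_measure g = density lborel (\<lambda>x. ennreal (sqrt (det (g x))))"

definition l2norm1 :: "'n::finite tensor2 \<Rightarrow> 'n tensor1 \<Rightarrow> real" where
  "l2norm1 g v = sqrt (\<integral>x. inner1 g v v x \<partial>volume_measure g)"

definition l2norm2 :: "'n::finite tensor2 \<Rightarrow> 'n tensor2 \<Rightarrow> real" where
  "l2norm2 g h = sqrt (\<integral>x. inner2 g h h x \<partial>volume_measure g)"

definition sol_metric :: "3 tensor2" where
  "sol_metric x = vector [vector [1, 0, 0],
                          vector [0, exp (2 * x $ 1), 0],
                          vector [0, 0, exp (- 2 * x $ 1)]]"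

definition sol_field :: "real \<Rightarrow> 3 vector_field" where
  "sol_field \<gamma> x = \<gamma> *\<^sub>R vector [- 2, 0, - 4 * x $ 3]
                 + (1 - \<gamma>) *\<^sub>R vector [2, - 4 * x $ 2, 0]"

end

theory Submission
  imports Defs
begin

text \<open>
  Let \<open>T\<^sub>k\<^sub>i\<^sub>j = \<nabla>\<^sub>k h\<^sub>i\<^sub>j - \<nabla>\<^sub>i h\<^sub>k\<^sub>j\<close>. Expanding \<open>\<bar>T\<bar>\<^sup>2\<close>, integrating by parts and commuting covariant
  derivatives gives \<open>\<integral> \<langle>\<Delta>\<^sub>\<ell> h, h\<rangle> = - \<parallel>T\<parallel>\<^sup>2 / 2 - \<parallel>\<delta> h\<parallel>\<^sup>2 + \<integral> (R\<^sub>i\<^sub>p\<^sub>q\<^sub>j h\<^sup>p\<^sup>q h\<^sup>i\<^sup>j - R\<^sub>i\<^sub>k h\<^sup>k\<^sub>j h\<^sup>i\<^sup>j)\<close>.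
  The field \<open>X\<close> has constant divergence \<open>- 4\<close> and acts on an orthonormal frame by constants, both
  independent of \<open>\<gamma>\<close>, so \<open>\<integral> \<langle>\<L>\<^sub>X h, h\<rangle>\<close> is also the integral of a quadratic form in the frame components of \<open>h\<close>.
  The total quadratic form is \<open>- 4 h\<^sub>1\<^sub>2\<^sup>2 - 4 h\<^sub>1\<^sub>3\<^sup>2 - 6 h\<^sub>2\<^sub>3\<^sup>2\<close> plus, on the diagonal entries, the form with
  matrix rows \<open>(-4, -1, -1)\<close>, \<open>(-1, -2, 1)\<close>, \<open>(-1, 1, -2)\<close>, whose largest eigenvalue is
  \<open>- (5 - sqrt 17) / 2\<close>, a root of \<open>\<lambda>\<^sup>2 + 5 \<lambda> + 2 = 0\<close>. All of this is carried out pointwise, up to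
  the divergence of a smooth compactly supported vector field.
\<close>

subsection \<open>Smooth functions and partial derivatives\<close>

lemma smooth_differentiable: "smooth f \<Longrightarrow> f differentiable at x"
  unfolding smooth_def by (metis fold_simps(1))

lemma smooth_pd: "smooth f \<Longrightarrow> smooth (pd i f)"
  unfolding smooth_def by (metis fold_simps(2))

lemma smooth_isCont: "smooth f \<Longrightarrow> isCont f x"
  by (simp add: differentiable_imp_continuous_within smooth_differentiable)

lemma smooth_continuous_on: "smooth f \<Longrightarrow> continuous_on A f"
  by (simp add: continuous_at_imp_continuous_on smooth_isCont)

lemma pd_eqI: "(f has_derivative f') (at x) \<Longrightarrow> pd i f x = f' (axis i 1)"
  unfolding pd_def by (metis frechet_derivative_at)

lemma pd_add:
  assumes "f differentiable at x" "g differentiable at x"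
  shows "pd i (\<lambda>x. f x + g x) x = pd i f x + pd i g x"
  using assms unfolding frechet_derivative_works
  by (subst pd_eqI, rule has_derivative_add) (auto simp: pd_def)

lemma pd_diff:
  assumes "f differentiable at x" "g differentiable at x"
  shows "pd i (\<lambda>x. f x - g x) x = pd i f x - pd i g x"
  using assms unfolding frechet_derivative_works
  by (subst pd_eqI, rule has_derivative_diff) (auto simp: pd_def)

lemma pd_mult:
  assumes "f differentiable at x" "g differentiable at x"
  shows "pd i (\<lambda>x. f x * g x) x = pd i f x * g x + f x * pd i g x"
  using assms unfolding frechet_derivative_works
  by (subst pd_eqI, rule has_derivative_mult) (auto simp: pd_def)

lemma pd_const [simp]: "pd i (\<lambda>x. c) = (\<lambda>x. 0)"
  by (rule ext, subst pd_eqI, rule has_derivative_const) auto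

lemma has_derivative_component: "((\<lambda>x. x $ k) has_derivative (\<lambda>h. h $ k)) (at (x::real^'n::finite))"
  by (rule bounded_linear.has_derivative[OF bounded_linear_vec_nth has_derivative_ident])

lemma pd_component: "pd i (\<lambda>x. x $ k) x = of_bool (i = k)"
  by (subst pd_eqI, rule has_derivative_component) (auto simp: axis_def)

lemma has_derivative_exp_component:
  "((\<lambda>x. exp (c * x $ k)) has_derivative (\<lambda>h. exp (c * x $ k) * (c * h $ k))) (at (x::real^'n::finite))"
  by (auto intro!: derivative_eq_intros has_derivative_component)

lemma pd_exp_component: "pd i (\<lambda>x. exp (c * x $ k)) x = (of_bool (i = k) * c) * exp (c * x $ k)"
  by (subst pd_eqI, rule has_derivative_exp_component) (auto simp: axis_def)

text \<open>Any class \<open>P\<close> of differentiable functions that is closed under all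
  \<open>pd i\<close> consists of smooth functions, so smoothness is shown below by exhibiting such
  a class.\<close>

lemma smooth_coinduct:
  assumes "P f"
    and diff: "\<And>f x. P f \<Longrightarrow> f differentiable at x"
    and pd: "\<And>f i. P f \<Longrightarrow> P (pd i f)"
  shows "smooth f"
proof -
  have "P (fold pd is f)" for "is"
    using \<open>P f\<close> by (induction "is" arbitrary: f) (auto intro: pd)
  then show ?thesis
    unfolding smooth_def using diff by blast
qed

lemma smooth_const [simp, intro]: "smooth (\<lambda>x. c)"
  by (rule smooth_coinduct[where P = "\<lambda>f. \<exists>c. f = (\<lambda>x. c)"]) auto

text \<open>By the product rule, products are closed under \<open>pd i\<close> only together with
  sums, so both operations are generated at once.\<close>

inductive smooth_algebra :: "(real ^ 'n::finite \<Rightarrow> real) \<Rightarrow> bool" where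
  base: "smooth f \<Longrightarrow> smooth_algebra f"
| add: "smooth_algebra f \<Longrightarrow> smooth_algebra g \<Longrightarrow> smooth_algebra (\<lambda>x. f x + g x)"
| mult: "smooth_algebra f \<Longrightarrow> smooth_algebra g \<Longrightarrow> smooth_algebra (\<lambda>x. f x * g x)"

lemma smooth_algebra_differentiable: "smooth_algebra f \<Longrightarrow> f differentiable at x"
  by (induction rule: smooth_algebra.induct)
    (auto intro: smooth_differentiable differentiable_add differentiable_mult)

lemma smooth_algebra_pd: "smooth_algebra f \<Longrightarrow> smooth_algebra (pd i f)"
proof (induction rule: smooth_algebra.induct)
  case (base f)
  then show ?case by (simp add: smooth_algebra.base smooth_pd)
next
  case (add f g)
  have "pd i (\<lambda>x. f x + g x) = (\<lambda>x. pd i f x + pd i g x)"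
    using add by (auto simp: pd_add smooth_algebra_differentiable)
  with add show ?case by (simp add: smooth_algebra.add)
next
  case (mult f g)
  have "pd i (\<lambda>x. f x * g x) = (\<lambda>x. pd i f x * g x + f x * pd i g x)"
    using mult by (auto simp: pd_mult smooth_algebra_differentiable)
  with mult show ?case by (simp add: smooth_algebra.add smooth_algebra.mult)
qed

lemma smooth_algebra_smooth: "smooth_algebra f \<Longrightarrow> smooth f"
  by (rule smooth_coinduct[where P = smooth_algebra])
    (auto intro: smooth_algebra_differentiable smooth_algebra_pd)

lemma smooth_add [intro]: "smooth f \<Longrightarrow> smooth g \<Longrightarrow> smooth (\<lambda>x. f x + g x)"
  by (rule smooth_algebra_smooth) (simp add: smooth_algebra.add smooth_algebra.base)

lemma smooth_mult [intro]: "smooth f \<Longrightarrow> smooth g \<Longrightarrow> smooth (\<lambda>x. f x * g x)"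
  by (rule smooth_algebra_smooth) (simp add: smooth_algebra.mult smooth_algebra.base)

lemma smooth_minus [intro]: "smooth f \<Longrightarrow> smooth (\<lambda>x. - f x)"
  using smooth_mult[of "\<lambda>x. -1" f] by simp

lemma smooth_diff [intro]: "smooth f \<Longrightarrow> smooth g \<Longrightarrow> smooth (\<lambda>x. f x - g x)"
  using smooth_add[of f "\<lambda>x. - g x"] by auto

lemma smooth_sum [intro]: "(\<And>i. i \<in> I \<Longrightarrow> smooth (f i)) \<Longrightarrow> smooth (\<lambda>x. \<Sum>i\<in>I. f i x)"
  by (induction I rule: infinite_finite_induct) auto

lemma smooth_power [intro]: "smooth f \<Longrightarrow> smooth (\<lambda>x. f x ^ n)"
  by (induction n) auto

text \<open>The multiples of one exponential are closed under \<open>pd i\<close>; the exponential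
  alone is not.\<close>

lemma smooth_exp_component [intro]: "smooth (\<lambda>x::real^'n::finite. exp (c * x $ k))"
proof (rule smooth_coinduct[where P = "\<lambda>f. \<exists>a. f = (\<lambda>x. a * exp (c * x $ k))"])
  show "f differentiable at x" if "\<exists>a. f = (\<lambda>x. a * exp (c * x $ k))" for f :: "real^'n \<Rightarrow> real" and x
    using that by (auto intro!: differentiable_mult differentiableI[OF has_derivative_exp_component])
  show "\<exists>a. pd i f = (\<lambda>x. a * exp (c * x $ k))"
    if "\<exists>a. f = (\<lambda>x. a * exp (c * x $ k))" for f :: "real^'n \<Rightarrow> real" and i
  proof -
    from that obtain a where f: "f = (\<lambda>x. a * exp (c * x $ k))" by auto
    have "pd i f = (\<lambda>x. (a * (of_bool (i = k) * c)) * exp (c * x $ k))"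
      unfolding f
      by (rule ext, subst pd_mult)
        (auto simp: pd_exp_component intro!: differentiableI[OF has_derivative_exp_component])
    then show ?thesis by blast
  qed
qed (auto intro: exI[of _ 1])

lemma smooth_component [intro]: "smooth (\<lambda>x::real^'n::finite. x $ k)"
proof (rule smooth_coinduct[where P = "\<lambda>f. f = (\<lambda>x. x $ k) \<or> (\<exists>c. f = (\<lambda>x. c))"])
  show "f differentiable at x" if "f = (\<lambda>x. x $ k) \<or> (\<exists>c. f = (\<lambda>x. c))" 
    for f :: "real^'n \<Rightarrow> real" and x
    using that by (auto intro!: differentiableI[OF has_derivative_component])
  show "pd i f = (\<lambda>x. x $ k) \<or> (\<exists>c. pd i f = (\<lambda>x. c))"
    if "f = (\<lambda>x. x $ k) \<or> (\<exists>c. f = (\<lambda>x. c))" for f :: "real^'n \<Rightarrow> real" and i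
    using that by (auto simp: pd_component[abs_def])
qed auto

section \<open>Mean values along coordinate axes and symmetry of second partial derivatives\<close>

lemma has_real_derivative_along_axis:
  assumes "f differentiable at (x + t *\<^sub>R axis i 1)"
  shows "((\<lambda>t. f (x + t *\<^sub>R axis i 1)) has_real_derivative pd i f (x + t *\<^sub>R axis i 1)) (at t)"
proof -
  let ?D = "frechet_derivative f (at (x + t *\<^sub>R axis i 1))"
  have "((\<lambda>t. x + t *\<^sub>R axis i 1) has_derivative (\<lambda>h. h *\<^sub>R axis i 1)) (at t)"
    by (auto intro!: derivative_eq_intros)
  from diff_chain_at[OF this] assms
  have "((\<lambda>t. f (x + t *\<^sub>R axis i 1)) has_derivative (\<lambda>h. ?D (h *\<^sub>R axis i 1))) (at t)"
    unfolding frechet_derivative_works by (simp add: o_def)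
  moreover have "?D (h *\<^sub>R axis i 1) = pd i f (x + t *\<^sub>R axis i 1) * h" for h
    using linear_cmul[OF linear_frechet_derivative[OF assms], of h "axis i 1"] by (simp add: pd_def)
  ultimately show ?thesis
    by (simp add: has_field_derivative_def)
qed

lemma mvt_along_axis:
  assumes "\<And>y. f differentiable at y" "0 < t"
  obtains \<xi> where "0 < \<xi>" "\<xi> < t" "f (x + t *\<^sub>R axis i 1) - f x = t * pd i f (x + \<xi> *\<^sub>R axis i 1)"
  using MVT2[of 0 t "\<lambda>t. f (x + t *\<^sub>R axis i 1)" "\<lambda>t. pd i f (x + t *\<^sub>R axis i 1)"]
    has_real_derivative_along_axis[OF assms(1)] assms(2) by auto

text \<open>The mean value theorem is used twice: in direction \<open>i\<close> for the difference
  of \<open>f\<close> and its translate by \<open>t\<close> along axis \<open>j\<close>, then in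
  direction \<open>j\<close> for \<open>pd i f\<close>.\<close>

lemma second_difference_mvt:
  assumes f: "smooth f" and t: "0 < t"
  obtains \<xi> \<eta> where "0 < \<xi>" "\<xi> < t" "0 < \<eta>" "\<eta> < t"
    "f (x + t *\<^sub>R axis i 1 + t *\<^sub>R axis j 1) - f (x + t *\<^sub>R axis i 1) - f (x + t *\<^sub>R axis j 1) + f x
      = t * (t * pd j (pd i f) (x + \<xi> *\<^sub>R axis i 1 + \<eta> *\<^sub>R axis j 1))"
proof -
  have "((\<lambda>r. f (t *\<^sub>R axis j 1 + x + r *\<^sub>R axis i 1) - f (x + r *\<^sub>R axis i 1)) has_real_derivative
      (pd i f (t *\<^sub>R axis j 1 + x + r *\<^sub>R axis i 1) - pd i f (x + r *\<^sub>R axis i 1))) (at r)" for r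
    by (intro DERIV_diff has_real_derivative_along_axis smooth_differentiable f)
  from MVT2[OF t this] obtain \<xi> where \<xi>: "0 < \<xi>" "\<xi> < t"
    "f (t *\<^sub>R axis j 1 + x + t *\<^sub>R axis i 1) - f (x + t *\<^sub>R axis i 1)
      - (f (t *\<^sub>R axis j 1 + x) - f x)
      = t * (pd i f (t *\<^sub>R axis j 1 + x + \<xi> *\<^sub>R axis i 1) - pd i f (x + \<xi> *\<^sub>R axis i 1))"
    by auto
  obtain \<eta> where \<eta>: "0 < \<eta>" "\<eta> < t"
    "pd i f (x + \<xi> *\<^sub>R axis i 1 + t *\<^sub>R axis j 1) - pd i f (x + \<xi> *\<^sub>R axis i 1)
      = t * pd j (pd i f) (x + \<xi> *\<^sub>R axis i 1 + \<eta> *\<^sub>R axis j 1)"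
    by (rule mvt_along_axis[of "pd i f" t "x + \<xi> *\<^sub>R axis i 1" j])
      (auto intro: smooth_differentiable smooth_pd f t)
  show ?thesis
    using that[OF \<xi>(1,2) \<eta>(1,2)] \<xi>(3) \<eta>(3) by (simp add: algebra_simps)
qed

text \<open>The second difference is symmetric in \<open>i\<close> and \<open>j\<close>, so the two
  mixed derivatives take a common value at points within \<open>2 * t\<close> of \<open>x\<close>;
  continuity of both gives equality at \<open>x\<close> as \<open>t\<close> shrinks.\<close>

lemma pd_commute:
  assumes f: "smooth f"
  shows "pd i (pd j f) x = pd j (pd i f) x"
proof -
  let ?y = "\<lambda>i j \<xi> \<eta>. x + \<xi> *\<^sub>R axis i 1 + \<eta> *\<^sub>R axis j 1"
  have near: "dist (?y i j \<xi> \<eta>) x < 2 * t" if "0 < \<xi>" "\<xi> < t" "0 < \<eta>" "\<eta> < t" for i j \<xi> \<eta> t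
  proof -
    have "dist (?y i j \<xi> \<eta>) x = norm (\<xi> *\<^sub>R axis i 1 + \<eta> *\<^sub>R axis j (1::real))"
      by (simp add: dist_norm add.assoc)
    also have "\<dots> \<le> norm (\<xi> *\<^sub>R axis i (1::real)) + norm (\<eta> *\<^sub>R axis j (1::real))"
      by (rule norm_triangle_ineq)
    finally show ?thesis using that by simp
  qed
  have "\<bar>pd i (pd j f) x - pd j (pd i f) x\<bar> \<le> 0 + e" if e: "0 < e" for e
  proof -
    have "isCont (pd i (pd j f)) x" "isCont (pd j (pd i f)) x"
      by (auto intro: smooth_isCont smooth_pd f)
    then obtain a b where ab: "0 < a" "0 < b"
      "\<And>y. dist y x < a \<Longrightarrow> dist (pd i (pd j f) y) (pd i (pd j f) x) < e / 2"
      "\<And>y. dist y x < b \<Longrightarrow> dist (pd j (pd i f) y) (pd j (pd i f) x) < e / 2"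
      using half_gt_zero[OF e] unfolding continuous_at_eps_delta by blast
    define t where "t = min a b / 2"
    have t: "0 < t" "2 * t \<le> a" "2 * t \<le> b" using ab by (auto simp: t_def)
    obtain \<xi> \<eta> where 1: "0 < \<xi>" "\<xi> < t" "0 < \<eta>" "\<eta> < t"
      "f (x + t *\<^sub>R axis i 1 + t *\<^sub>R axis j 1) - f (x + t *\<^sub>R axis i 1) - f (x + t *\<^sub>R axis j 1) + f x
        = t * (t * pd j (pd i f) (?y i j \<xi> \<eta>))"
      by (rule second_difference_mvt[OF f t(1)])
    obtain \<xi>' \<eta>' where 2: "0 < \<xi>'" "\<xi>' < t" "0 < \<eta>'" "\<eta>' < t"
      "f (x + t *\<^sub>R axis j 1 + t *\<^sub>R axis i 1) - f (x + t *\<^sub>R axis j 1) - f (x + t *\<^sub>R axis i 1) + f x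
        = t * (t * pd i (pd j f) (?y j i \<xi>' \<eta>'))"
      by (rule second_difference_mvt[OF f t(1)])
    have "t * (t * pd j (pd i f) (?y i j \<xi> \<eta>)) = t * (t * pd i (pd j f) (?y j i \<xi>' \<eta>'))"
      using 1(5) 2(5) unfolding add.assoc[of x] add.commute[of "t *\<^sub>R axis j 1"] by linarith
    then have "pd j (pd i f) (?y i j \<xi> \<eta>) = pd i (pd j f) (?y j i \<xi>' \<eta>')"
      using t(1) by simp
    moreover have "dist (?y i j \<xi> \<eta>) x < b" "dist (?y j i \<xi>' \<eta>') x < a"
      by (rule less_le_trans[OF near[OF 1(1-4)] t(3)], rule less_le_trans[OF near[OF 2(1-4)] t(2)])
    note ab(4)[OF this(1)] ab(3)[OF this(2)]
    ultimately show ?thesis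
      unfolding dist_real_def by linarith
  qed
  from field_le_epsilon[OF this] show ?thesis by simp
qed

subsection \<open>Integrals of derivatives of compactly supported functions\<close>

text \<open>A fixed closed set containing the support serves all derivatives and products at once,
  whereas the support itself changes from function to function.\<close>

definition zero_off :: "'a set \<Rightarrow> ('a \<Rightarrow> 'b::zero) \<Rightarrow> bool" where
  "zero_off K f \<longleftrightarrow> (\<forall>x. x \<notin> K \<longrightarrow> f x = 0)"

lemma zero_off_pd:
  assumes "closed K" "zero_off K f"
  shows "zero_off K (pd i f)"
  unfolding zero_off_def
proof (intro allI impI)
  fix x assume "x \<notin> K"
  have "(f has_derivative (\<lambda>h. 0)) (at x)"
  proof (rule has_derivative_transform_within_open)
    show "((\<lambda>y. 0) has_derivative (\<lambda>h. 0)) (at x)" by simp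
    show "open (- K)" using assms by auto
  qed (use \<open>x \<notin> K\<close> assms in \<open>auto simp: zero_off_def\<close>)
  then show "pd i f x = 0" by (simp add: pd_eqI)
qed

lemma integrable_continuous_zero_off:
  fixes f :: "'a::euclidean_space \<Rightarrow> real"
  assumes "compact K" "continuous_on UNIV f" "zero_off K f"
  shows "integrable lborel f"
proof -
  have "integrable lborel (\<lambda>x. indicator K x *\<^sub>R f x)"
    by (rule borel_integrable_compact) (use assms continuous_on_subset in auto)
  also have "(\<lambda>x. indicator K x *\<^sub>R f x) = f"
    using assms by (auto simp: zero_off_def fun_eq_iff indicator_def)
  finally show ?thesis .
qed

lemma integral_lborel_translate:
  fixes f :: "'a::euclidean_space \<Rightarrow> real"
  assumes "f \<in> borel_measurable borel"
  shows "(\<integral>x. f (v + x) \<partial>lborel) = (\<integral>x. f x \<partial>lborel)"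
  using integral_distr[of "(+) v" lborel borel f] assms by (simp add: lborel_distr_plus)

text \<open>Translation invariance makes the integral of every difference quotient vanish; dominated
  convergence passes to the derivative.\<close>

lemma integral_pd_zero:
  fixes f :: "real ^ 'n::finite \<Rightarrow> real"
  assumes f: "smooth f" and K: "compact K" and fK: "zero_off K f"
  shows "(\<integral>x. pd i f x \<partial>lborel) = 0"
proof -
  let ?e = "axis i 1 :: real ^ 'n"
  let ?t = "\<lambda>n. 1 / real (Suc n)"
  let ?q = "\<lambda>n x. (f (?t n *\<^sub>R ?e + x) - f x) / ?t n"
  have cont: "continuous_on UNIV f" "continuous_on UNIV (pd i f)"
    by (auto intro: smooth_continuous_on smooth_pd f)
  have pK: "zero_off K (pd i f)"
    using K fK by (intro zero_off_pd) (auto intro: compact_imp_closed)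
  have int: "integrable lborel f" "integrable lborel (pd i f)"
    using integrable_continuous_zero_off K cont fK pK by auto
  have meas: "f \<in> borel_measurable borel" "pd i f \<in> borel_measurable borel"
    using cont by (auto intro: borel_measurable_continuous_onI)
  have "compact (pd i f ` K)"
    using K cont by (auto intro: compact_continuous_image continuous_on_subset)
  then obtain M0 where "\<And>x. x \<in> K \<Longrightarrow> \<bar>pd i f x\<bar> \<le> M0"
    using bounded_real compact_imp_bounded by (metis imageI)
  then have M: "\<bar>pd i f x\<bar> \<le> max 0 M0" for x
    using pK by (cases "x \<in> K") (force simp: zero_off_def)+
  obtain R where R: "\<And>x. x \<in> K \<Longrightarrow> norm x \<le> R"
    using compact_imp_bounded[OF K] bounded_iff by blast
  \<comment> \<open>Each step \<open>?t n\<close> is at most 1, so outside the ball of radius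
    \<open>R + 1\<close> both \<open>x\<close> and its translate miss \<open>K\<close> and the
    quotient vanishes. Inside, the quotient is a value of \<open>pd i f\<close> by the mean value
    theorem.\<close>
  let ?w = "\<lambda>x. indicator (cball 0 (R + 1)) x *\<^sub>R max 0 M0 :: real"
  have "(\<lambda>n. \<integral>x. ?q n x \<partial>lborel) \<longlonglongrightarrow> (\<integral>x. pd i f x \<partial>lborel)"
  proof (rule integral_dominated_convergence[where w = ?w])
    show "pd i f \<in> borel_measurable lborel" "\<And>n. ?q n \<in> borel_measurable lborel"
      using meas by measurable
    show "integrable lborel ?w"
      by (rule borel_integrable_compact) auto
    show "AE x in lborel. (\<lambda>n. ?q n x) \<longlonglongrightarrow> pd i f x"
    proof (rule AE_I2)
      fix x
      have "((\<lambda>h. (f (x + h *\<^sub>R ?e) - f x) / h) \<longlongrightarrow> pd i f x) (at 0)"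
        using has_real_derivative_along_axis[of f x 0 i] smooth_differentiable[OF f]
        by (simp add: DERIV_def)
      moreover have "filterlim ?t (at 0) sequentially"
        using LIMSEQ_Suc[OF lim_1_over_n] unfolding filterlim_at by (auto simp del: of_nat_Suc)
      ultimately show "(\<lambda>n. ?q n x) \<longlonglongrightarrow> pd i f x"
        by (auto dest: filterlim_compose simp: add.commute simp del: of_nat_Suc)
    qed
    show "AE x in lborel. norm (?q n x) \<le> ?w x" for n
    proof (rule AE_I2)
      fix x
      have t: "0 < ?t n" "?t n \<le> 1" by auto
      show "norm (?q n x) \<le> ?w x"
      proof (cases "x \<in> cball 0 (R + 1)")
        case True
        obtain \<xi> where "f (x + ?t n *\<^sub>R ?e) - f x = ?t n * pd i f (x + \<xi> *\<^sub>R ?e)"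
          using mvt_along_axis[OF smooth_differentiable[OF f] t(1)] by metis
        then have "?q n x = pd i f (x + \<xi> *\<^sub>R ?e)"
          using t(1) by (simp add: add.commute)
        with M True show ?thesis by simp
      next
        case False
        then have "R + 1 < norm x" by simp
        moreover have "norm x \<le> norm (?t n *\<^sub>R ?e + x) + norm (?t n *\<^sub>R ?e)"
          by (metis add_diff_cancel_left' norm_triangle_ineq2 diff_le_eq norm_minus_commute
              norm_triangle_sub add.commute)
        moreover have "norm (?t n *\<^sub>R ?e) \<le> 1" using t by simp
        ultimately have "x \<notin> K" "?t n *\<^sub>R ?e + x \<notin> K"
          using R by (smt (verit))+
        with fK False show ?thesis by (simp add: zero_off_def)
      qed
    qed
  qed
  moreover have "(\<integral>x. ?q n x \<partial>lborel) = 0" for n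
  proof -
    have "integrable lborel (\<lambda>x. f (?t n *\<^sub>R ?e + x))"
      using int(1) integrable_distr_eq[of "(+) (?t n *\<^sub>R ?e)" lborel borel f] meas(1)
      by (simp add: lborel_distr_plus)
    then show ?thesis
      using int(1) integral_lborel_translate[OF meas(1)] by simp
  qed
  ultimately show ?thesis
    by (simp only: LIMSEQ_const_iff)
qed

subsection \<open>The orthonormal frame\<close>

text \<open>The vector fields \<open>e\<^sub>i = \<partial>\<^sub>i / scl i\<close> form a \<open>sol_metric\<close>-orthonormal frame with
  \<open>[e\<^sub>1, e\<^sub>2] = - e\<^sub>2\<close>, \<open>[e\<^sub>1, e\<^sub>3] = e\<^sub>3\<close>, \<open>[e\<^sub>2, e\<^sub>3] = 0\<close>. Below, \<open>fd i\<close> is differentiation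
  along \<open>e\<^sub>i\<close>, \<open>conn k i l\<close> is the \<open>e\<^sub>l\<close>-component of \<open>\<nabla>\<close> of \<open>e\<^sub>i\<close> along \<open>e\<^sub>k\<close>, and \<open>sect i j\<close> is the
  sectional curvature of the plane of \<open>e\<^sub>i\<close> and \<open>e\<^sub>j\<close> (for \<open>i \<noteq> j\<close>). The functions with prefix
  \<open>frame\<close> are components in this frame.\<close>

definition wt :: "3 \<Rightarrow> real" where
  "wt i = of_bool (i = 2) - of_bool (i = 3)"

definition scl :: "3 \<Rightarrow> real ^ 3 \<Rightarrow> real" where
  "scl i x = exp (wt i * x $ 1)"

definition fd :: "3 \<Rightarrow> (real ^ 3 \<Rightarrow> real) \<Rightarrow> real ^ 3 \<Rightarrow> real" where
  "fd i f x = exp (- wt i * x $ 1) * pd i f x"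

definition conn :: "3 \<Rightarrow> 3 \<Rightarrow> 3 \<Rightarrow> real" where
  "conn k i l = wt k * (of_bool (i = 1 \<and> l = k) - of_bool (i = k \<and> l = 1))"

definition frame_cd2 :: "(3 \<Rightarrow> 3 \<Rightarrow> real ^ 3 \<Rightarrow> real) \<Rightarrow> 3 \<Rightarrow> 3 \<Rightarrow> 3 \<Rightarrow> real ^ 3 \<Rightarrow> real" where
  "frame_cd2 u k i j x = fd k (u i j) x
     - (\<Sum>l\<in>UNIV. conn k i l * u l j x) - (\<Sum>l\<in>UNIV. conn k j l * u i l x)"

definition frame_cd3 ::
    "(3 \<Rightarrow> 3 \<Rightarrow> 3 \<Rightarrow> real ^ 3 \<Rightarrow> real) \<Rightarrow> 3 \<Rightarrow> 3 \<Rightarrow> 3 \<Rightarrow> 3 \<Rightarrow> real ^ 3 \<Rightarrow> real" where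
  "frame_cd3 T m k i j x = fd m (T k i j) x
     - (\<Sum>l\<in>UNIV. conn m k l * T l i j x) - (\<Sum>l\<in>UNIV. conn m i l * T k l j x)
     - (\<Sum>l\<in>UNIV. conn m j l * T k i l x)"

definition sect :: "3 \<Rightarrow> 3 \<Rightarrow> real" where
  "sect i j = (if i = 1 \<or> j = 1 then - (wt i + wt j)\<^sup>2 else - wt i * wt j)"

definition frame_riemann :: "3 \<Rightarrow> 3 \<Rightarrow> 3 \<Rightarrow> 3 \<Rightarrow> real" where
  "frame_riemann i j k l = sect i j * (of_bool (j = k \<and> i = l) - of_bool (i = k \<and> j = l))"

lemma wt_simps [simp]: "wt 1 = 0" "wt 2 = 1" "wt 3 = -1"
  by (auto simp: wt_def)

lemma scl_nonzero [simp]: "scl i x \<noteq> 0"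
  by (simp add: scl_def)

lemma smooth_scl: "smooth (scl i)"
  unfolding scl_def[abs_def] by (rule smooth_exp_component)

lemma fd_scl: "fd i f x = pd i f x / scl i x"
  by (simp add: fd_def scl_def exp_minus field_simps)

lemma pd_fd: "pd i f x = scl i x * fd i f x"
  by (simp add: fd_scl)

lemma pd_scl: "pd k (scl i) x = of_bool (k = 1) * wt i * scl i x"
  unfolding scl_def[abs_def] pd_exp_component by simp

lemma smooth_fd: "smooth f \<Longrightarrow> smooth (fd i f)"
  unfolding fd_def[abs_def] by (intro smooth_mult smooth_exp_component smooth_pd)

section \<open>Metric, Christoffel symbols and curvature in coordinates\<close>

lemma sol_metric_nth: "sol_metric x $ i $ j = of_bool (i = j) * (scl i x)\<^sup>2"
  using exhaust_3[of i] exhaust_3[of j]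
  by (auto simp: sol_metric_def scl_def exp_double[symmetric] power2_eq_square exp_add[symmetric])

lemma ginv_sol_metric: "ginv sol_metric x $ i $ j = of_bool (i = j) / (scl i x)\<^sup>2"
proof -
  let ?B = "\<chi> i j. of_bool (i = j) / (scl i x)\<^sup>2 :: real^3^3"
  have AB: "sol_metric x ** ?B = mat 1" "?B ** sol_metric x = mat 1"
    by (auto simp: matrix_matrix_mult_def sol_metric_nth mat_def vec_eq_iff of_bool_def
        if_distrib[of "\<lambda>a. _ * a"] if_distrib[of "\<lambda>a. a * _"] if_distrib[of "\<lambda>a. a / _"] cong: if_cong)
  \<comment> \<open>\<open>matrix_inv\<close> is a choice of some inverse, so uniqueness is needed
    to identify it.\<close>
  have "A' = ?B" if "sol_metric x ** A' = mat 1" for A'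
  proof -
    have "A' = (?B ** sol_metric x) ** A'" using AB(2) by simp
    also have "\<dots> = ?B" unfolding matrix_mul_assoc[symmetric] that by simp
    finally show ?thesis .
  qed
  then have "matrix_inv (sol_metric x) = ?B"
    unfolding matrix_inv_def using AB by (intro some_equality) blast+
  then show ?thesis by (simp add: ginv_def)
qed

lemma pd_sol_metric:
  "pd k (\<lambda>y. sol_metric y $ i $ j) x = of_bool (i = j \<and> k = 1) * (2 * wt i * (scl i x)\<^sup>2)"
proof -
  have "pd k (\<lambda>y. sol_metric y $ i $ j) x = pd k (\<lambda>y. of_bool (i = j) * (scl i y * scl i y)) x"
    by (simp add: sol_metric_nth power2_eq_square)
  also have "\<dots> = of_bool (i = j \<and> k = 1) * (2 * wt i * (scl i x)\<^sup>2)"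
    by (simp add: pd_mult smooth_differentiable smooth_scl smooth_mult pd_scl power2_eq_square)
  finally show ?thesis .
qed

lemma scl_simps [simp]: "scl 1 x = 1" "scl 3 x = inverse (scl 2 x)"
  by (simp_all add: scl_def exp_minus)

lemma christoffel_sol_metric:
  "christoffel sol_metric l k i = (\<lambda>x. wt k * of_bool (i = 1 \<and> l = k) + wt i * of_bool (k = 1 \<and> l = i)
     - wt k * of_bool (l = 1 \<and> k = i) * (scl k x * scl k x))"
proof
  fix x
  show "christoffel sol_metric l k i x = wt k * of_bool (i = 1 \<and> l = k)
      + wt i * of_bool (k = 1 \<and> l = i) - wt k * of_bool (l = 1 \<and> k = i) * (scl k x * scl k x)"
    using exhaust_3[of i] exhaust_3[of k] exhaust_3[of l]
    by (elim disjE; simp add: christoffel_def pd_sol_metric ginv_sol_metric sum_3 power2_eq_square)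
qed

text \<open>Leibniz rule for the coordinate field written as \<open>scl i\<close> times a frame
  field: the first summand is the frame connection, the last one the derivative of
  \<open>scl i\<close> in direction \<open>k\<close>.\<close>

lemma christoffel_scl:
  "christoffel sol_metric l k i x * scl l x
     = scl k x * scl i x * conn k i l + of_bool (k = 1 \<and> l = i) * wt i * scl i x"
  using exhaust_3[of i] exhaust_3[of k] exhaust_3[of l]
  by (auto simp: christoffel_sol_metric conn_def)

lemma pd_christoffel_sol_metric:
  "pd j (christoffel sol_metric l k i) x
     = - (of_bool (l = 1 \<and> k = i \<and> j = 1) * 2 * (wt k)\<^sup>2 * (scl k x * scl k x))"
proof -
  have "smooth (\<lambda>x. scl k x * scl k x)" "smooth (\<lambda>x. c * (scl k x * scl k x))" for c
    by (intro smooth_mult smooth_scl smooth_const)+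
  then show ?thesis
    unfolding christoffel_sol_metric
    by (simp add: pd_diff pd_mult smooth_differentiable smooth_scl pd_scl power2_eq_square)
qed

text \<open>The curvature operator is diagonal on the planes spanned by pairs of frame fields, so
  three sectional curvatures determine the tensor.\<close>

lemma riemann_sol_metric:
  "riemann sol_metric i j k l x = scl i x * scl j x * scl k x * scl l x * frame_riemann i j k l"
proof -
  have "riemann sol_metric i j k l x = riemann_up sol_metric i j k l x * (scl l x)\<^sup>2"
    by (simp add: riemann_def sol_metric_nth of_bool_def
        if_distrib[of "\<lambda>a. _ * a"] if_distrib[of "\<lambda>a. a * _"] cong: if_cong)
  also have "\<dots> = scl i x * scl j x * scl k x * scl l x * frame_riemann i j k l"
    using exhaust_3[of i] exhaust_3[of j] exhaust_3[of k] exhaust_3[of l]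
    by (elim disjE; simp add: riemann_up_def fun_cong[OF christoffel_sol_metric] pd_christoffel_sol_metric sum_3
      frame_riemann_def sect_def power2_eq_square; simp add: field_simps)
  finally show ?thesis .
qed

lemma ricci_sol_metric:
  "ricci sol_metric x $ i $ j = - (2 * of_bool (i = 1 \<and> j = 1))"
  using exhaust_3[of i] exhaust_3[of j]
  by (elim disjE; simp add: ricci_def ginv_sol_metric riemann_sol_metric sum_3
      frame_riemann_def sect_def power2_eq_square)

lemma sum_delta_mult:
  fixes f :: "'a::finite \<Rightarrow> real"
  shows "(\<Sum>l\<in>UNIV. f l * of_bool (l = i)) = f i" "(\<Sum>l\<in>UNIV. f l * of_bool (i = l)) = f i"
    "(\<Sum>l\<in>UNIV. of_bool (l = i) * f l) = f i" "(\<Sum>l\<in>UNIV. of_bool (i = l) * f l) = f i"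
  by (simp_all add: of_bool_def if_distrib[of "\<lambda>a. _ * a"] if_distrib[of "\<lambda>a. a * _"] cong: if_cong)

lemma sum_ginv:
  "(\<Sum>k\<in>UNIV. ginv sol_metric x $ i $ k * f k) = f i / (scl i x)\<^sup>2"
  "(\<Sum>k\<in>UNIV. ginv sol_metric x $ k $ i * f k) = f i / (scl i x)\<^sup>2"
proof -
  have "(\<Sum>k\<in>UNIV. ginv sol_metric x $ i $ k * f k)
      = (\<Sum>k\<in>UNIV. of_bool (i = k) * (f k / (scl i x)\<^sup>2))"
    "(\<Sum>k\<in>UNIV. ginv sol_metric x $ k $ i * f k)
      = (\<Sum>k\<in>UNIV. of_bool (k = i) * (f k / (scl k x)\<^sup>2))"
    by (simp_all add: ginv_sol_metric mult.commute)
  then show "(\<Sum>k\<in>UNIV. ginv sol_metric x $ i $ k * f k) = f i / (scl i x)\<^sup>2"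
    "(\<Sum>k\<in>UNIV. ginv sol_metric x $ k $ i * f k) = f i / (scl i x)\<^sup>2"
    by (simp_all only: sum_delta_mult)
qed

lemma sum_christoffel:
  "(\<Sum>l\<in>UNIV. christoffel sol_metric l k i x * (scl l x * f l))
     = scl k x * scl i x * (\<Sum>l\<in>UNIV. conn k i l * f l) + of_bool (k = 1) * wt i * scl i x * f i"
proof -
  have "(\<Sum>l\<in>UNIV. christoffel sol_metric l k i x * (scl l x * f l))
      = (\<Sum>l\<in>UNIV. (scl k x * scl i x * conn k i l + of_bool (k = 1 \<and> l = i) * wt i * scl i x) * f l)"
    by (intro sum.cong refl) (simp flip: christoffel_scl)
  also have "\<dots> = (\<Sum>l\<in>UNIV. scl k x * scl i x * (conn k i l * f l)
      + of_bool (l = i) * (of_bool (k = 1) * wt i * scl i x * f l))"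
    by (intro sum.cong refl) (simp add: of_bool_conj algebra_simps)
  finally show ?thesis
    by (simp only: sum.distrib sum_delta_mult sum_distrib_left)
qed

lemma pd_scl_mult:
  assumes "smooth f"
  shows "smooth (\<lambda>y. scl i y * f y)"
    "pd k (\<lambda>y. scl i y * f y) x = scl i x * (pd k f x + of_bool (k = 1) * wt i * f x)"
  using assms by (auto simp: pd_mult smooth_differentiable smooth_scl pd_scl algebra_simps
      intro: smooth_mult)

lemma sol_field_nth:
  "sol_field \<gamma> x $ k = 2 * (1 - 2 * \<gamma>) * of_bool (k = 1)
     + (- 4 * (\<gamma> * of_bool (k = 3) + (1 - \<gamma>) * of_bool (k = 2))) * x $ k"
  using exhaust_3[of k] by (auto simp: sol_field_def algebra_simps)

lemma smooth_sol_field: "smooth (\<lambda>x. sol_field \<gamma> x $ k)"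
  unfolding sol_field_nth by (intro smooth_add smooth_mult smooth_component smooth_const)

lemma pd_sol_field:
  "pd i (\<lambda>x. sol_field \<gamma> x $ k) x
     = of_bool (i = k) * (- 4 * (\<gamma> * of_bool (k = 3) + (1 - \<gamma>) * of_bool (k = 2)))"
  unfolding sol_field_nth
  by (simp add: pd_add pd_mult smooth_differentiable smooth_mult smooth_component pd_component)

section \<open>Passage from coordinate components to frame components\<close>

locale framed_tensor2 =
  fixes u :: "3 \<Rightarrow> 3 \<Rightarrow> real ^ 3 \<Rightarrow> real" and h :: "3 tensor2"
  assumes smooth_u: "smooth (u i j)"
    and u_sym: "u i j = u j i"
    and h_frame: "h x $ i $ j = scl i x * (scl j x * u i j x)"
begin

lemma pd_h:
  "pd k (\<lambda>y. h y $ i $ j) x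
    = scl i x * (scl j x * (pd k (u i j) x + of_bool (k = 1) * (wt i + wt j) * u i j x))"
  unfolding h_frame by (simp add: pd_scl_mult smooth_u algebra_simps)

text \<open>The \<open>of_bool (k = 1)\<close> terms from differentiating the factors
  \<open>scl\<close> cancel those in \<open>sum_christoffel\<close>, which leaves only the frame
  connection.\<close>

lemma cov_deriv2_frame:
  "cov_deriv2 sol_metric h x $ k $ i $ j
     = scl k x * (scl i x * (scl j x * frame_cd2 u k i j x))"
proof -
  have "(\<Sum>l\<in>UNIV. christoffel sol_metric l k i x * h x $ l $ j)
      = scl k x * scl i x * (\<Sum>l\<in>UNIV. conn k i l * (scl j x * u l j x))
        + of_bool (k = 1) * wt i * scl i x * (scl j x * u i j x)"
    unfolding h_frame by (rule sum_christoffel)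
  moreover have "(\<Sum>l\<in>UNIV. christoffel sol_metric l k j x * h x $ i $ l)
      = scl k x * scl j x * (\<Sum>l\<in>UNIV. conn k j l * (scl i x * u i l x))
        + of_bool (k = 1) * wt j * scl j x * (scl i x * u i j x)"
    using sum_christoffel[of k j x "\<lambda>l. scl i x * u i l x"]
    by (simp add: h_frame ac_simps)
  ultimately show ?thesis
    unfolding cov_deriv2_def frame_cd2_def
    by (simp add: pd_h pd_fd sum_distrib_left algebra_simps)
qed

lemma smooth_frame_cd2: "smooth (frame_cd2 u k i j)"
  unfolding frame_cd2_def[abs_def]
  by (intro smooth_diff smooth_sum smooth_mult smooth_const smooth_fd smooth_u)

lemma cov_deriv3_frame:
  "cov_deriv3 sol_metric (cov_deriv2 sol_metric h) m k i j x
     = scl m x * (scl k x * (scl i x * (scl j x * frame_cd3 (frame_cd2 u) m k i j x)))"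
proof -
  let ?N = "frame_cd2 u"
  have "(\<Sum>l\<in>UNIV. christoffel sol_metric l m k x * cov_deriv2 sol_metric h x $ l $ i $ j)
      = scl m x * scl k x * (\<Sum>l\<in>UNIV. conn m k l * (scl i x * (scl j x * ?N l i j x)))
        + of_bool (m = 1) * wt k * scl k x * (scl i x * (scl j x * ?N k i j x))"
    unfolding cov_deriv2_frame by (rule sum_christoffel)
  moreover have "(\<Sum>l\<in>UNIV. christoffel sol_metric l m i x * cov_deriv2 sol_metric h x $ k $ l $ j)
      = scl m x * scl i x * (\<Sum>l\<in>UNIV. conn m i l * (scl k x * (scl j x * ?N k l j x)))
        + of_bool (m = 1) * wt i * scl i x * (scl k x * (scl j x * ?N k i j x))"
    using sum_christoffel[of m i x "\<lambda>l. scl k x * (scl j x * ?N k l j x)"]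
    by (simp add: cov_deriv2_frame ac_simps)
  moreover have "(\<Sum>l\<in>UNIV. christoffel sol_metric l m j x * cov_deriv2 sol_metric h x $ k $ i $ l)
      = scl m x * scl j x * (\<Sum>l\<in>UNIV. conn m j l * (scl k x * (scl i x * ?N k i l x)))
        + of_bool (m = 1) * wt j * scl j x * (scl k x * (scl i x * ?N k i j x))"
    using sum_christoffel[of m j x "\<lambda>l. scl k x * (scl i x * ?N k i l x)"]
    by (simp add: cov_deriv2_frame ac_simps)
  moreover have "pd m (\<lambda>y. cov_deriv2 sol_metric h y $ k $ i $ j) x
      = scl k x * (scl i x * (scl j x * (pd m (?N k i j) x
          + of_bool (m = 1) * (wt k + wt i + wt j) * ?N k i j x)))"
    unfolding cov_deriv2_frame
    by (simp add: pd_scl_mult smooth_frame_cd2 algebra_simps)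
  ultimately show ?thesis
    unfolding cov_deriv3_def frame_cd3_def
    by (simp add: pd_fd sum_distrib_left algebra_simps)
qed

lemma rough_laplacian_frame:
  "rough_laplacian sol_metric h x $ i $ j
     = scl i x * (scl j x * (\<Sum>m\<in>UNIV. frame_cd3 (frame_cd2 u) m m i j x))"
  unfolding rough_laplacian_def
  by (simp add: sum_ginv cov_deriv3_frame sum_distrib_left power2_eq_square)

lemma divergence_frame:
  "divergence sol_metric h x $ j = - (scl j x * (\<Sum>i\<in>UNIV. frame_cd2 u i i j x))"
  unfolding divergence_def
  by (simp add: sum_ginv cov_deriv2_frame sum_distrib_left power2_eq_square)

text \<open>The only nonzero Ricci component is -2 in the direction of the first axis, so each index
  equal to 1 contributes +2.\<close>

lemma lichnerowicz_frame:
  "lichnerowicz sol_metric h x $ i $ j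
     = scl i x * (scl j x * ((\<Sum>m\<in>UNIV. frame_cd3 (frame_cd2 u) m m i j x)
         + 2 * (\<Sum>p\<in>UNIV. \<Sum>q\<in>UNIV. frame_riemann i p q j * u p q x)
         + 2 * (of_bool (i = 1) + of_bool (j = 1)) * u i j x))"
proof -
  have "(\<Sum>a\<in>UNIV. \<Sum>b\<in>UNIV. riemann sol_metric i p q j x * ginv sol_metric x $ p $ a
          * ginv sol_metric x $ q $ b * h x $ a $ b)
      = scl i x * (scl j x * (frame_riemann i p q j * u p q x))" for p q
  proof -
    have "(\<Sum>a\<in>UNIV. \<Sum>b\<in>UNIV. riemann sol_metric i p q j x * ginv sol_metric x $ p $ a
          * ginv sol_metric x $ q $ b * h x $ a $ b)
      = riemann sol_metric i p q j x * (\<Sum>a\<in>UNIV. ginv sol_metric x $ p $ a *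
         (\<Sum>b\<in>UNIV. ginv sol_metric x $ q $ b * h x $ a $ b))"
      by (simp add: sum_distrib_left mult.assoc)
    then show ?thesis
      by (simp only: sum_ginv) (simp add: h_frame riemann_sol_metric power2_eq_square)
  qed
  moreover have "(\<Sum>k\<in>UNIV. \<Sum>l\<in>UNIV. ginv sol_metric x $ k $ l * ricci sol_metric x $ i $ l * h x $ k $ j)
      = - 2 * of_bool (i = 1) * (scl i x * (scl j x * u i j x))"
    "(\<Sum>k\<in>UNIV. \<Sum>l\<in>UNIV. ginv sol_metric x $ k $ l * ricci sol_metric x $ j $ l * h x $ i $ k)
      = - 2 * of_bool (j = 1) * (scl i x * (scl j x * u i j x))"
    by (simp_all add: sum_ginv mult.assoc) (auto simp: ricci_sol_metric sum_3 h_frame)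
  ultimately show ?thesis
    unfolding lichnerowicz_def
    by (simp only: vec_lambda_beta rough_laplacian_frame) (simp add: sum_distrib_left algebra_simps)
qed

text \<open>For an index 2 or 3, the derivative of \<open>scl\<close> along the field and the
  derivative of the field itself add up to -2:
  \<open>2 * (1 - 2 * \<gamma>) - 4 * (1 - \<gamma>)\<close> and
  \<open>- 2 * (1 - 2 * \<gamma>) - 4 * \<gamma>\<close>. Hence \<gamma> survives only in the
  transport term.\<close>

lemma lie_deriv_frame:
  "lie_deriv (sol_field \<gamma>) h x $ i $ j
     = scl i x * (scl j x * ((\<Sum>k\<in>UNIV. sol_field \<gamma> x $ k * pd k (u i j) x)
         - 2 * (of_bool (i \<noteq> 1) + of_bool (j \<noteq> 1)) * u i j x))"
  unfolding lie_deriv_def pd_h pd_sol_field vec_lambda_beta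
  using exhaust_3[of i] exhaust_3[of j]
  by (elim disjE; simp add: sum_3 h_frame sol_field_def algebra_simps)

end

lemma inner2_frame:
  assumes "\<And>i j. A x $ i $ j = scl i x * (scl j x * a i j)" "\<And>i j. B x $ i $ j = scl i x * (scl j x * b i j)"
  shows "inner2 sol_metric A B x = (\<Sum>i\<in>UNIV. \<Sum>j\<in>UNIV. a i j * b i j)"
proof -
  have "inner2 sol_metric A B x = (\<Sum>i\<in>UNIV. \<Sum>j\<in>UNIV. A x $ i $ j *
     (\<Sum>k\<in>UNIV. ginv sol_metric x $ i $ k * (\<Sum>l\<in>UNIV. ginv sol_metric x $ j $ l * B x $ k $ l)))"
    unfolding inner2_def by (simp add: sum_distrib_left ac_simps)
  then show ?thesis
    by (simp only: sum_ginv) (simp add: assms power2_eq_square)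
qed

lemma inner1_frame:
  assumes "\<And>i. A x $ i = - (scl i x * a i)"
  shows "inner1 sol_metric A A x = (\<Sum>i\<in>UNIV. (a i)\<^sup>2)"
proof -
  have "inner1 sol_metric A A x = (\<Sum>i\<in>UNIV. A x $ i * (\<Sum>k\<in>UNIV. ginv sol_metric x $ i $ k * A x $ k))"
    unfolding inner1_def by (simp add: sum_distrib_left ac_simps)
  then show ?thesis
    by (simp only: sum_ginv) (simp add: assms power2_eq_square)
qed

lemma volume_measure_sol_metric: "volume_measure sol_metric = lborel"
proof -
  have "det (sol_metric x) = 1" for x
    by (simp add: det_3 sol_metric_nth power_inverse)
  then show ?thesis by (simp add: volume_measure_def density_1)
qed

subsection \<open>A pointwise Weitzenboeck formula\<close>

lemma fd_const [simp]: "fd i (\<lambda>x. c) x = 0"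
  by (simp add: fd_def)

lemma fd_add: "smooth f \<Longrightarrow> smooth g \<Longrightarrow> fd i (\<lambda>x. f x + g x) x = fd i f x + fd i g x"
  by (simp add: fd_def pd_add smooth_differentiable algebra_simps)

lemma fd_diff: "smooth f \<Longrightarrow> smooth g \<Longrightarrow> fd i (\<lambda>x. f x - g x) x = fd i f x - fd i g x"
  by (simp add: fd_def pd_diff smooth_differentiable algebra_simps)

lemma fd_mult: "smooth f \<Longrightarrow> smooth g \<Longrightarrow> fd i (\<lambda>x. f x * g x) x = fd i f x * g x + f x * fd i g x"
  by (simp add: fd_def pd_mult smooth_differentiable algebra_simps)

lemma fd_fd:
  assumes "smooth f"
  shows "fd i (fd j f) x = exp (- wt i * x $ 1) * exp (- wt j * x $ 1) * pd i (pd j f) x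
    - of_bool (i = 1) * wt j * fd j f x"
proof -
  have "pd i (fd j f) x = of_bool (i = 1) * (- wt j) * exp (- wt j * x $ 1) * pd j f x
      + exp (- wt j * x $ 1) * pd i (pd j f) x"
    unfolding fd_def[of j, abs_def]
    by (subst pd_mult)
      (simp_all only: pd_exp_component smooth_differentiable smooth_exp_component smooth_pd assms)
  then show ?thesis
    unfolding fd_def[of i] by (cases "i = 1") (simp_all add: fd_def algebra_simps)
qed

text \<open>These are the frame brackets, oriented as rewrite rules that move the smaller index
  outwards, so that second derivatives have a normal form.\<close>

lemma fd_commute:
  assumes "smooth f"
  shows "fd 2 (fd 1 f) x = fd 1 (fd 2 f) x + fd 2 f x"
    "fd 3 (fd 1 f) x = fd 1 (fd 3 f) x - fd 3 f x"
    "fd 3 (fd 2 f) x = fd 2 (fd 3 f) x"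
  by (simp_all add: fd_fd assms pd_commute[OF assms, of 2 1] pd_commute[OF assms, of 3 1]
      pd_commute[OF assms, of 3 2])

context framed_tensor2
begin

text \<open>The exterior covariant derivative of \<open>h\<close> viewed as a covector-valued
  1-form, that is, the tensor \<open>T\<close> of the overview.\<close>

definition exterior_cd :: "3 \<Rightarrow> 3 \<Rightarrow> 3 \<Rightarrow> real ^ 3 \<Rightarrow> real" where
  "exterior_cd k i j x = frame_cd2 u k i j x - frame_cd2 u i k j x"

text \<open>This is \<open>- \<delta> h\<close> in the frame; only its square enters the
  estimate.\<close>

definition frame_div :: "3 \<Rightarrow> real ^ 3 \<Rightarrow> real" where
  "frame_div j x = (\<Sum>i\<in>UNIV. frame_cd2 u i i j x)"

text \<open>
  The first sum comes from integrating \<open>\<langle>\<Delta> h, h\<rangle>\<close> by parts against the skew part of \<open>\<nabla> h\<close> instead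
  of \<open>\<nabla> h\<close>; the second one completes the remaining second derivatives to \<open>\<bar>\<delta> h\<bar>\<^sup>2\<close>.
\<close>

definition flux :: "3 \<Rightarrow> real ^ 3 \<Rightarrow> real" where
  "flux k x = (\<Sum>i\<in>UNIV. \<Sum>j\<in>UNIV. u i j x * exterior_cd k i j x)
     + (\<Sum>j\<in>UNIV. u k j x * frame_div j x)"

lemma u_sym_simps: "u 2 1 = u 1 2" "u 3 1 = u 1 3" "u 3 2 = u 2 3"
  by (simp_all add: u_sym)

text \<open>Equations between functions, so that they can be used below an outer \<open>fd\<close>.
  The first one has no connection term because \<open>wt 1 = 0\<close>.\<close>

lemma frame_cd2_simps:
  "frame_cd2 u 1 i j = fd 1 (u i j)"
  "frame_cd2 u 2 1 1 = (\<lambda>x. fd 2 (u 1 1) x - 2 * u 1 2 x)"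
  "frame_cd2 u 2 1 2 = (\<lambda>x. fd 2 (u 1 2) x - u 2 2 x + u 1 1 x)"
  "frame_cd2 u 2 2 1 = (\<lambda>x. fd 2 (u 1 2) x - u 2 2 x + u 1 1 x)"
  "frame_cd2 u 2 1 3 = (\<lambda>x. fd 2 (u 1 3) x - u 2 3 x)"
  "frame_cd2 u 2 3 1 = (\<lambda>x. fd 2 (u 1 3) x - u 2 3 x)"
  "frame_cd2 u 2 2 2 = (\<lambda>x. fd 2 (u 2 2) x + 2 * u 1 2 x)"
  "frame_cd2 u 2 2 3 = (\<lambda>x. fd 2 (u 2 3) x + u 1 3 x)"
  "frame_cd2 u 2 3 2 = (\<lambda>x. fd 2 (u 2 3) x + u 1 3 x)"
  "frame_cd2 u 2 3 3 = fd 2 (u 3 3)"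
  "frame_cd2 u 3 1 1 = (\<lambda>x. fd 3 (u 1 1) x + 2 * u 1 3 x)"
  "frame_cd2 u 3 1 2 = (\<lambda>x. fd 3 (u 1 2) x + u 2 3 x)"
  "frame_cd2 u 3 2 1 = (\<lambda>x. fd 3 (u 1 2) x + u 2 3 x)"
  "frame_cd2 u 3 1 3 = (\<lambda>x. fd 3 (u 1 3) x + u 3 3 x - u 1 1 x)"
  "frame_cd2 u 3 3 1 = (\<lambda>x. fd 3 (u 1 3) x + u 3 3 x - u 1 1 x)"
  "frame_cd2 u 3 2 2 = fd 3 (u 2 2)"
  "frame_cd2 u 3 2 3 = (\<lambda>x. fd 3 (u 2 3) x - u 1 2 x)"
  "frame_cd2 u 3 3 2 = (\<lambda>x. fd 3 (u 2 3) x - u 1 2 x)"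
  "frame_cd2 u 3 3 3 = (\<lambda>x. fd 3 (u 3 3) x - 2 * u 1 3 x)"
  by (auto simp: frame_cd2_def sum_3 conn_def u_sym_simps fun_eq_iff)

text \<open>The frame fields are divergence-free, so the sum of \<open>fd k (flux k)\<close> is a
  true divergence. The squares of \<open>exterior_cd\<close> run over three index pairs and give
  half of the full norm by skew symmetry. The last bracket is the Ricci term minus the Riemann term
  left by commuting covariant derivatives. Once all derivatives are expanded and put in normal form,
  the claim is a polynomial identity.\<close>

lemma frame_weitzenboeck:
  "(\<Sum>i\<in>UNIV. \<Sum>j\<in>UNIV. (\<Sum>m\<in>UNIV. frame_cd3 (frame_cd2 u) m m i j x) * u i j x)
    = (\<Sum>k\<in>UNIV. fd k (flux k) x) - (\<Sum>j\<in>UNIV. (frame_div j x)\<^sup>2)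
      - (\<Sum>j\<in>UNIV. (exterior_cd 1 2 j x)\<^sup>2 + (exterior_cd 1 3 j x)\<^sup>2 + (exterior_cd 2 3 j x)\<^sup>2)
      + (2 * (u 1 1 x * u 2 2 x) + 2 * (u 1 1 x * u 3 3 x) - 2 * (u 2 2 x * u 3 3 x) - 2 * (u 1 1 x)\<^sup>2
         - 4 * (u 1 2 x)\<^sup>2 - 4 * (u 1 3 x)\<^sup>2 + 2 * (u 2 3 x)\<^sup>2)"
  unfolding frame_cd3_def flux_def[abs_def] exterior_cd_def[abs_def] frame_div_def[abs_def] sum_3
    frame_cd2_simps
  by (simp add: conn_def frame_cd2_simps fd_add fd_diff fd_mult smooth_u smooth_add smooth_diff
      smooth_mult smooth_fd u_sym_simps fd_commute)
    (simp add: algebra_simps power2_eq_square)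

end

subsection \<open>The energy estimate\<close>

text \<open>The exponential depends on the first coordinate only and is constant for
  \<open>k = 1\<close>, so it may be moved inside the derivative.\<close>

lemma fd_eq_pd:
  assumes "smooth f"
  shows "fd k f x = pd k (\<lambda>x. exp (- wt k * x $ 1) * f x) x"
proof -
  have "pd k (\<lambda>x. exp (- wt k * x $ 1) * f x) x
      = of_bool (k = 1) * (- wt k) * exp (- wt k * x $ 1) * f x + exp (- wt k * x $ 1) * pd k f x"
    by (subst pd_mult)
      (simp_all only: pd_exp_component smooth_differentiable smooth_exp_component assms)
  then show ?thesis
    by (cases "k = 1") (simp_all add: fd_def)
qed

text \<open>The form splits into the direction \<open>b - c\<close>, with eigenvalue 3, and a block
  on \<open>a\<close> and \<open>b + c\<close> with characteristic polynomial
  \<open>\<omega>\<^sup>2 - 5 * \<omega> + 2\<close>. Multiplying by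
  \<open>2 * (4 - \<omega>) > 0\<close> permits completing the square in \<open>a\<close> without
  division.\<close>

lemma sol_quadratic_form_nonpos:
  fixes a b c \<omega> :: real
  assumes "\<omega>\<^sup>2 - 5 * \<omega> + 2 = 0" "\<omega> < 3"
  shows "\<omega> * (a\<^sup>2 + b\<^sup>2 + c\<^sup>2) \<le> 4 * a\<^sup>2 + 2 * b\<^sup>2 + 2 * c\<^sup>2 + 2 * (a * b) + 2 * (a * c) - 2 * (b * c)"
    (is "?l \<le> ?r")
proof -
  have "2 * (4 - \<omega>) * (?r - ?l)
    = 2 * ((4 - \<omega>) * a + b + c)\<^sup>2 + (3 - \<omega>) * (4 - \<omega>) * (b - c)\<^sup>2
      + (\<omega>\<^sup>2 - 5 * \<omega> + 2) * (b + c)\<^sup>2"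
    by (simp add: power2_eq_square algebra_simps)
  also have "\<dots> \<ge> 0"
    using assms by simp
  finally show ?thesis
    using assms(2) by (simp add: zero_le_mult_iff)
qed

context framed_tensor2
begin

definition transport_flux :: "real \<Rightarrow> 3 \<Rightarrow> real ^ 3 \<Rightarrow> real" where
  "transport_flux \<gamma> k x = sol_field \<gamma> x $ k * (\<Sum>i\<in>UNIV. \<Sum>j\<in>UNIV. (u i j x)\<^sup>2 / 2)"

lemma smooth_frame_div: "smooth (frame_div j)"
  unfolding frame_div_def[abs_def] by (intro smooth_sum smooth_frame_cd2)

lemma smooth_flux: "smooth (flux k)"
  unfolding flux_def[abs_def] exterior_cd_def
  by (intro smooth_add smooth_sum smooth_mult smooth_diff smooth_u smooth_frame_cd2 smooth_frame_div)

lemma smooth_transport_flux: "smooth (transport_flux \<gamma> k)"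
  unfolding transport_flux_def[abs_def] divide_inverse
  by (intro smooth_sum smooth_mult smooth_power smooth_u smooth_sol_field smooth_const)

text \<open>The soliton field has divergence -4, which accounts for the term with factor 2.\<close>

lemma transport_by_parts:
  "(\<Sum>i\<in>UNIV. \<Sum>j\<in>UNIV. (\<Sum>k\<in>UNIV. sol_field \<gamma> x $ k * pd k (u i j) x) * u i j x)
     = (\<Sum>k\<in>UNIV. pd k (transport_flux \<gamma> k) x) + 2 * (\<Sum>i\<in>UNIV. \<Sum>j\<in>UNIV. (u i j x)\<^sup>2)"
proof -
  have "pd k (\<lambda>x. (u i j x)\<^sup>2 / 2) x = pd k (u i j) x * u i j x" for i j k
    using pd_mult[of "\<lambda>x. u i j x * u i j x" x "\<lambda>x. 1 / 2" k]
    by (simp add: power2_eq_square pd_mult smooth_differentiable smooth_u smooth_mult)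
  moreover have "smooth (\<lambda>x. (u i j x)\<^sup>2 / 2)" for i j
    unfolding divide_inverse by (intro smooth_mult smooth_power smooth_u smooth_const)
  ultimately have *: "pd k (transport_flux \<gamma> k) x
      = pd k (\<lambda>x. sol_field \<gamma> x $ k) x * (\<Sum>i\<in>UNIV. \<Sum>j\<in>UNIV. (u i j x)\<^sup>2 / 2)
        + sol_field \<gamma> x $ k * (\<Sum>i\<in>UNIV. \<Sum>j\<in>UNIV. pd k (u i j) x * u i j x)" for k
    unfolding transport_flux_def[abs_def] sum_3
    by (simp add: pd_mult pd_add smooth_differentiable smooth_sol_field smooth_add)
  show ?thesis
    by (simp add: * pd_sol_field sum_3) (simp add: field_simps)
qed

text \<open>No multiple of \<open>u i j\<close> appears: the Ricci terms, the zeroth-order part of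
  the Lie derivative and \<open>- 4 * h\<close> cancel for every index pair.\<close>

definition frame_lin :: "real \<Rightarrow> 3 \<Rightarrow> 3 \<Rightarrow> real ^ 3 \<Rightarrow> real" where
  "frame_lin \<gamma> i j x = (\<Sum>m\<in>UNIV. frame_cd3 (frame_cd2 u) m m i j x)
     + 2 * (\<Sum>p\<in>UNIV. \<Sum>q\<in>UNIV. frame_riemann i p q j * u p q x)
     - (\<Sum>k\<in>UNIV. sol_field \<gamma> x $ k * pd k (u i j) x)"

lemma linearization_frame:
  "linearization sol_metric (sol_field \<gamma>) 4 h x $ i $ j = scl i x * (scl j x * frame_lin \<gamma> i j x)"
proof -
  have "2 * (of_bool (i = 1) + of_bool (j = 1)) = 4 - 2 * (of_bool (i \<noteq> 1) + of_bool (j \<noteq> 1) :: real)"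
    by (cases "i = 1"; cases "j = 1") simp_all
  then show ?thesis
    unfolding linearization_def frame_lin_def
    by (simp add: lichnerowicz_frame lie_deriv_frame h_frame algebra_simps)
qed

lemma smooth_frame_lin: "smooth (frame_lin \<gamma> i j)"
  unfolding frame_lin_def[abs_def] frame_cd3_def
  by (intro smooth_add smooth_diff smooth_sum smooth_mult smooth_const smooth_fd smooth_frame_cd2
      smooth_pd smooth_u smooth_sol_field)

lemma frame_energy_le:
  assumes "\<omega>\<^sup>2 - 5 * \<omega> + 2 = 0" "\<omega> < 2"
  shows "(\<Sum>i\<in>UNIV. \<Sum>j\<in>UNIV. frame_lin \<gamma> i j x * u i j x) + (\<Sum>j\<in>UNIV. (frame_div j x)\<^sup>2)
       + \<omega> * (\<Sum>i\<in>UNIV. \<Sum>j\<in>UNIV. (u i j x)\<^sup>2)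
     \<le> (\<Sum>k\<in>UNIV. fd k (flux k) x) - (\<Sum>k\<in>UNIV. pd k (transport_flux \<gamma> k) x)"
proof -
  have R: "(\<Sum>i\<in>UNIV. \<Sum>j\<in>UNIV. 2 * (\<Sum>p\<in>UNIV. \<Sum>q\<in>UNIV. frame_riemann i p q j * u p q x) * u i j x)
    = 4 * ((u 1 2 x)\<^sup>2 + (u 1 3 x)\<^sup>2 - (u 2 3 x)\<^sup>2 - u 1 1 x * u 2 2 x - u 1 1 x * u 3 3 x + u 2 2 x * u 3 3 x)"
    by (simp add: sum_3 frame_riemann_def sect_def u_sym_simps power2_eq_square algebra_simps)
  \<comment> \<open>Off-diagonal entries occur twice in the norm, so their coefficients -4, -4 and
    -6 in the total form require \<omega> \<le> 2; the surplus on \<open>u 2 3\<close> is absorbed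
    by \<open>zero_le_power2\<close>.\<close>
  have "\<omega> * (u i j x)\<^sup>2 \<le> 2 * (u i j x)\<^sup>2" for i j
    using assms(2) by (intro mult_right_mono) auto
  note off = this[of 1 2] this[of 1 3] this[of 2 3]
  have E: "0 \<le> (\<Sum>j\<in>UNIV. (exterior_cd 1 2 j x)\<^sup>2 + (exterior_cd 1 3 j x)\<^sup>2 + (exterior_cd 2 3 j x)\<^sup>2)"
    by (intro sum_nonneg) auto
  have U: "c * (\<Sum>i\<in>UNIV. \<Sum>j\<in>UNIV. (u i j x)\<^sup>2) = c * ((u 1 1 x)\<^sup>2 + (u 2 2 x)\<^sup>2 + (u 3 3 x)\<^sup>2)
      + 2 * (c * (u 1 2 x)\<^sup>2) + 2 * (c * (u 1 3 x)\<^sup>2) + 2 * (c * (u 2 3 x)\<^sup>2)" for c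
    by (simp add: sum_3 u_sym_simps distrib_left)
  have Q: "\<omega> * ((u 1 1 x)\<^sup>2 + (u 2 2 x)\<^sup>2 + (u 3 3 x)\<^sup>2) \<le> 4 * (u 1 1 x)\<^sup>2 + 2 * (u 2 2 x)\<^sup>2
      + 2 * (u 3 3 x)\<^sup>2 + 2 * (u 1 1 x * u 2 2 x) + 2 * (u 1 1 x * u 3 3 x) - 2 * (u 2 2 x * u 3 3 x)"
    using assms by (intro sol_quadratic_form_nonpos) auto
  have "(\<Sum>i\<in>UNIV. \<Sum>j\<in>UNIV. frame_lin \<gamma> i j x * u i j x)
    = (\<Sum>i\<in>UNIV. \<Sum>j\<in>UNIV. (\<Sum>m\<in>UNIV. frame_cd3 (frame_cd2 u) m m i j x) * u i j x)
      + (\<Sum>i\<in>UNIV. \<Sum>j\<in>UNIV. 2 * (\<Sum>p\<in>UNIV. \<Sum>q\<in>UNIV. frame_riemann i p q j * u p q x) * u i j x)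
      - (\<Sum>i\<in>UNIV. \<Sum>j\<in>UNIV. (\<Sum>k\<in>UNIV. sol_field \<gamma> x $ k * pd k (u i j) x) * u i j x)"
    unfolding frame_lin_def by (simp only: sum.distrib sum_subtractf distrib_right left_diff_distrib)
  with off E Q zero_le_power2[of "u 2 3 x"] show ?thesis
    unfolding frame_weitzenboeck transport_by_parts R U by argo
qed

end

theorem proposition6:
  fixes \<gamma> \<omega> :: real
  defines "\<omega> \<equiv> (5 - sqrt 17) / 2"
  shows "\<omega> > 0 \<and>
    (\<forall>h :: 3 tensor2. smooth_tensor2 h \<and> symmetric_tensor2 h \<and> compactly_supported h \<longrightarrow>
       (\<integral>x. inner2 sol_metric (linearization sol_metric (sol_field \<gamma>) 4 h) h x
          \<partial>volume_measure sol_metric)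
       \<le> - (l2norm1 sol_metric (divergence sol_metric h))\<^sup>2 - \<omega> * (l2norm2 sol_metric h)\<^sup>2)"
proof (intro conjI allI impI, goal_cases)
  case 1
  have "sqrt 17 < sqrt (5\<^sup>2)" unfolding real_sqrt_less_iff by simp
  then show ?case by (simp add: \<omega>_def)
next
  case (2 h)
  have \<omega>: "\<omega>\<^sup>2 - 5 * \<omega> + 2 = 0" "\<omega> < 2"
  proof -
    have "sqrt (1\<^sup>2) < sqrt 17" unfolding real_sqrt_less_iff by simp
    then show "\<omega> < 2" by (simp add: \<omega>_def)
  qed (simp add: \<omega>_def power2_eq_square field_simps)
  \<comment> \<open>Explicit exponentials instead of division by \<open>scl\<close>, so that the
    smoothness rules for products apply.\<close>
  define u where "u i j x = exp (- wt i * x $ 1) * (exp (- wt j * x $ 1) * h x $ i $ j)" for i j x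
  define K where "K = closure {x. h x \<noteq> 0}"
  have K: "compact K" "closed K" "zero_off K h"
    using 2 closure_subset[of "{x. h x \<noteq> 0}"]
    by (auto simp: compactly_supported_def K_def zero_off_def)
  interpret framed_tensor2 u h
  proof
    show "smooth (u i j)" for i j
      unfolding u_def[abs_def] using 2
      by (intro smooth_mult smooth_exp_component) (auto simp: smooth_tensor2_def)
    have "h x $ i $ j = h x $ j $ i" for x i j
      using 2 unfolding symmetric_tensor2_def transpose_def vec_eq_iff by auto
    then show "u i j = u j i" for i j
      by (auto simp: u_def fun_eq_iff)
    show "h x $ i $ j = scl i x * (scl j x * u i j x)" for x i j
      by (simp add: u_def scl_def exp_minus field_simps)
  qed
  have uK: "u i j x = 0" if "x \<notin> K" for i j x
    using K(3) that by (simp add: u_def zero_off_def)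
  have "zero_off K (fd k (u i j))" for k i j
    using zero_off_pd[OF K(2), of "u i j"] uK by (simp add: zero_off_def fd_def)
  with uK have divK: "frame_div j x = 0" if "x \<notin> K" for j x
    using that by (simp add: frame_div_def frame_cd2_def zero_off_def)
  let ?A = "\<lambda>x. \<Sum>i\<in>UNIV. \<Sum>j\<in>UNIV. frame_lin \<gamma> i j x * u i j x"
  let ?B = "\<lambda>x. \<Sum>j\<in>UNIV. (frame_div j x)\<^sup>2"
  let ?C = "\<lambda>x. \<Sum>i\<in>UNIV. \<Sum>j\<in>UNIV. (u i j x)\<^sup>2"
  \<comment> \<open>Both fluxes combined into one compactly supported field in coordinates, whose
    divergence integrates to zero.\<close>
  define G where "G k x = exp (- wt k * x $ 1) * flux k x - transport_flux \<gamma> k x" for k x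
  have G: "smooth (G k)" "zero_off K (G k)" for k
    unfolding G_def[abs_def]
    by (intro smooth_diff smooth_mult smooth_exp_component smooth_flux smooth_transport_flux)
      (simp add: zero_off_def flux_def transport_flux_def uK)
  have "integrable lborel ?A" "integrable lborel ?B" "integrable lborel ?C"
    by (intro integrable_continuous_zero_off[OF K(1)] smooth_continuous_on smooth_sum smooth_mult
          smooth_power smooth_frame_lin smooth_u smooth_frame_div;
        simp add: zero_off_def uK divK)+
  note int = this
  have intG: "integrable lborel (pd k (G k))" for k
    by (intro integrable_continuous_zero_off[OF K(1)] smooth_continuous_on smooth_pd zero_off_pd G K)
  have "?A x + ?B x + \<omega> * ?C x \<le> (\<Sum>k\<in>UNIV. pd k (G k) x)" for x
  proof -
    have "pd k (G k) x = fd k (flux k) x - pd k (transport_flux \<gamma> k) x" for k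
      unfolding G_def[abs_def] fd_eq_pd[OF smooth_flux]
      by (intro pd_diff smooth_differentiable smooth_mult smooth_exp_component smooth_flux
          smooth_transport_flux)
    with frame_energy_le[OF \<omega>, of \<gamma> x] show ?thesis
      by (simp add: sum_subtractf)
  qed
  then have "(\<integral>x. ?A x + ?B x + \<omega> * ?C x \<partial>lborel) \<le> (\<integral>x. (\<Sum>k\<in>UNIV. pd k (G k) x) \<partial>lborel)"
    using int intG by (intro integral_mono) auto
  also have "\<dots> = 0"
    using intG by (simp add: integral_pd_zero[OF G(1) K(1) G(2)])
  finally have "integral\<^sup>L lborel ?A + integral\<^sup>L lborel ?B + \<omega> * integral\<^sup>L lborel ?C \<le> 0"
    using int by simp
  moreover have "inner2 sol_metric (linearization sol_metric (sol_field \<gamma>) 4 h) h x = ?A x" for x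
    by (rule inner2_frame) (rule linearization_frame h_frame)+
  moreover have "inner2 sol_metric h h x = ?C x" for x
    unfolding power2_eq_square by (rule inner2_frame) (rule h_frame)+
  moreover have "inner1 sol_metric (divergence sol_metric h) (divergence sol_metric h) x = ?B x" for x
    by (rule inner1_frame) (simp add: divergence_frame frame_div_def)
  \<comment> \<open>The norms are square roots of these integrals; nonnegativity lets their squares
    return the integrals.\<close>
  moreover have "0 \<le> integral\<^sup>L lborel ?B" "0 \<le> integral\<^sup>L lborel ?C"
    by (intro Bochner_Integration.integral_nonneg sum_nonneg; simp)+
  ultimately show ?case
    by (simp add: l2norm1_def l2norm2_def volume_measure_sol_metric)
qed

end
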